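(* Let $A\in\mathbb{R}^{n\times n}$ be a symmetric positive definite matrix and let $B\in\mathbb{R}^{m\times n}$ and $C\in\mathbb{R}^{p\times m}$ be full row rank matrices. Suppose that $\lambda$ is an eigenvalue of the PESS preconditioned matrix $\mathcal{P}_{PESS}^{-1}\mathcal{A}$. Then, for $s\geq\frac12$, $$|\lambda-1|<1,$$ i.e., the spectrum of $\mathcal{P}_{PESS}^{-1}\mathcal{A}$ is entirely contained in a disk centered at $(1,0)$ with radius strictly smaller than $1$.
   Context: The saddle point matrix is $\mathcal{A}=\begin{bmatrix}A&B^T&0\\-B&0&-C^T\\0&C&0\end{bmatrix}$. $\Lambda_1\in\mathbb{R}^{n\times n}$, $\Lambda_2\in\mathbb{R}^{m\times m}$, $\Lambda_3\in\mathbb{R}^{p\times p}$ are symmetric positive definite matrices, $\Sigma=\mathrm{diag}(\Lambda_1,\Lambda_2,\Lambda_3)$, and for $s>0$ the PESS preconditioner is $$\mathcal{P}_{PESS}=\Sigma+s\mathcal{A}=\begin{bmatrix}\Lambda_1+sA&sB^T&0\\-sB&\Lambda_2&-sC^T\\0&sC&\Lambda_3\end{bmatrix},$$ which is nonsingular. Eigenvalues are complex numbers in general. *)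

theory Defs
  imports
    "Jordan_Normal_Form.Gauss_Jordan_Elimination"
    "Jordan_Normal_Form.DL_Rank"
    "Jordan_Normal_Form.Spectral_Radius"
begin

definition sym_pos_def :: "nat \<Rightarrow> real mat \<Rightarrow> bool" where
  "sym_pos_def n M \<longleftrightarrow> M \<in> carrier_mat n n \<and> transpose_mat M = M \<and>
     (\<forall>v \<in> carrier_vec n. v \<noteq> 0\<^sub>v n \<longrightarrow> v \<bullet> (M *\<^sub>v v) > 0)"

(* The parameter of vec_space.rank is the dimension of the ambient space of the columns,
   i.e. the number of rows. *)
definition full_row_rank :: "real mat \<Rightarrow> bool" where
  "full_row_rank M \<longleftrightarrow> vec_space.rank (dim_row M) M = dim_row M"

(* Column-wise counterpart of append_rows (the infix @\<^sub>r); it binds tighter, so that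
   M11 @\<^sub>c M12 @\<^sub>r M21 @\<^sub>c M22 reads as a block matrix, row by row. *)
definition append_cols :: "'a :: zero mat \<Rightarrow> 'a mat \<Rightarrow> 'a mat" (infixr "@\<^sub>c" 68) where
  "M @\<^sub>c N = four_block_mat M N (0\<^sub>m 0 (dim_col M)) (0\<^sub>m 0 (dim_col N))"

lemma carrier_append_cols [simp, intro]:
  "M \<in> carrier_mat nr nc1 \<Longrightarrow> N \<in> carrier_mat nr nc2 \<Longrightarrow> M @\<^sub>c N \<in> carrier_mat nr (nc1 + nc2)"
  unfolding append_cols_def by auto

(* For A, B, C of dimensions n x n, m x n, p x m, this has dimension n + m + p. *)
definition saddle_mat :: "real mat \<Rightarrow> real mat \<Rightarrow> real mat \<Rightarrow> real mat" where
  "saddle_mat A B C =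
     (let n = dim_col B; m = dim_row B; p = dim_row C in
         A        @\<^sub>c transpose_mat B @\<^sub>c 0\<^sub>m n p
      @\<^sub>r (- B)    @\<^sub>c 0\<^sub>m m m         @\<^sub>c (- transpose_mat C)
      @\<^sub>r 0\<^sub>m p n @\<^sub>c C               @\<^sub>c 0\<^sub>m p p)"

definition pess_mat ::
  "real mat \<Rightarrow> real mat \<Rightarrow> real mat \<Rightarrow> real \<Rightarrow> real mat \<Rightarrow> real mat \<Rightarrow> real mat \<Rightarrow> real mat" where
  "pess_mat L1 L2 L3 s A B C = diag_block_mat [L1, L2, L3] + s \<cdot>\<^sub>m saddle_mat A B C"

(* mat_inverse returns an option; the value below is the inverse exactly because the
   preconditioner is nonsingular, which is not assumed here. *)
definition pess_preconditioned ::
  "real mat \<Rightarrow> real mat \<Rightarrow> real mat \<Rightarrow> real \<Rightarrow> real mat \<Rightarrow> real mat \<Rightarrow> real mat \<Rightarrow> real mat" where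
  "pess_preconditioned L1 L2 L3 s A B C =
     the (mat_inverse (pess_mat L1 L2 L3 s A B C)) * saddle_mat A B C"

lemma saddle_mat_carrier:
  assumes "A \<in> carrier_mat n n" "B \<in> carrier_mat m n" "C \<in> carrier_mat p m"
  shows "saddle_mat A B C \<in> carrier_mat (n + (m + p)) (n + (m + p))"
  using assms unfolding saddle_mat_def Let_def
  by (intro carrier_append_rows carrier_append_cols) auto

lemma pess_mat_blocks:
  assumes "A \<in> carrier_mat n n" "B \<in> carrier_mat m n" "C \<in> carrier_mat p m"
    "L1 \<in> carrier_mat n n" "L2 \<in> carrier_mat m m" "L3 \<in> carrier_mat p p"
  shows "pess_mat L1 L2 L3 s A B C =
         (L1 + s \<cdot>\<^sub>m A)  @\<^sub>c (s \<cdot>\<^sub>m transpose_mat B) @\<^sub>c 0\<^sub>m n p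
      @\<^sub>r (- (s \<cdot>\<^sub>m B))  @\<^sub>c L2                    @\<^sub>c (- (s \<cdot>\<^sub>m transpose_mat C))
      @\<^sub>r 0\<^sub>m p n        @\<^sub>c (s \<cdot>\<^sub>m C)             @\<^sub>c L3"
  using assms unfolding pess_mat_def saddle_mat_def Let_def append_rows_def append_cols_def
  by (intro eq_matI) (auto simp: Let_def)

end

(* Write M for the saddle point matrix, S for the block diagonal matrix and P = S + s M. If
   T = P^-1 M and T x = z x, then M x = z P x, and pairing with x gives w = z (h + s w) with
   h = x* S x > 0 and w = x* M x. The real part of w is the form of A at the leading block of x,
   since the off-diagonal blocks of M are skew. When Re w > 0,
   |h + s w|^2 - |w - (h + s w)|^2 = 2 h Re w + (2 s - 1) |w|^2 > 0, which is |z - 1| < 1.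
   Re w = 0 is impossible: the leading block of x would vanish, and then the full row ranks of B
   and C force x = 0. All of this is carried out on the real and imaginary parts u, v of x. *)
theory Submission
  imports Defs
begin

section \<open>Linear algebra: row rank, real and imaginary parts, inverses, definite forms\<close>

text \<open>A maximal independent set of columns has \<open>r\<close> elements, hence is a basis, so
  the columns span the whole space. The kernel condition makes \<open>y\<close> orthogonal to every
  column, therefore to every vector, and testing with unit vectors kills each entry.\<close>

lemma full_row_rank_transpose_kernel:
  assumes M: "M \<in> carrier_mat r c" and rank: "full_row_rank M"
    and y: "y \<in> carrier_vec r" and ker: "transpose_mat M *\<^sub>v y = 0\<^sub>v c"
  shows "y = 0\<^sub>v r"
proof -
  interpret vec_space "TYPE(real)" r .
  have rk: "rank M = r" using rank M unfolding full_row_rank_def by simp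
  have cols: "set (cols M) \<subseteq> carrier_vec r" using M cols_dim by blast
  obtain S where S: "finite S" "maximal S (\<lambda>T. T \<subseteq> set (cols M) \<and> lin_indpt T)"
    using maximal_exists_superset[of "set (cols M)" "\<lambda>T. T \<subseteq> set (cols M) \<and> lin_indpt T" "{}"]
      finite_lin_indpt2[of "{}"] by auto
  have "card S = r" using rank_card_indpt[OF M S(2)] rk by simp
  moreover have SM: "S \<subseteq> set (cols M)" and li: "lin_indpt S" using S(2) unfolding maximal_def by auto
  ultimately have "basis S"
    using dim_li_is_basis[OF fin_dim S(1) _ li] dim_is_n cols by auto
  then have "span S = carrier_vec r" unfolding basis_def by simp
  then have span: "span (set (cols M)) = carrier_vec r"
    using span_is_monotone[OF SM] span_closed[OF cols] by auto
  have "y \<bullet> x = 0" if x: "x \<in> set (cols M)" for x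
  proof -
    obtain j where j: "j < c" "x = col M j"
      using x M by (auto simp: cols_def)
    have "(transpose_mat M *\<^sub>v y) $ j = 0" using ker j by simp
    then have "x \<bullet> y = 0" using j M by simp
    then show ?thesis using comm_scalar_prod[OF y, of x] x cols by auto
  qed
  then have "y \<in> orthogonal_complement (set (cols M))"
    unfolding orthogonal_complement_def using y by auto
  then have "y \<in> orthogonal_complement (carrier_vec r)"
    using in_orthogonal_complement_span[OF cols] span by simp
  then have "y \<bullet> unit_vec r i = 0" if "i < r" for i
    unfolding orthogonal_complement_def using unit_vec_carrier by blast
  then show ?thesis using y by (intro eq_vecI) auto
qed

lemma map_vec_Re_mult:
  fixes x :: "complex vec"
  assumes "A \<in> carrier_mat nr nc" "x \<in> carrier_vec nc"
  shows "map_vec Re (map_mat complex_of_real A *\<^sub>v x) = A *\<^sub>v map_vec Re x"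
  using assms by (intro eq_vecI) (auto simp: scalar_prod_def)

lemma map_vec_Im_mult:
  fixes x :: "complex vec"
  assumes "A \<in> carrier_mat nr nc" "x \<in> carrier_vec nc"
  shows "map_vec Im (map_mat complex_of_real A *\<^sub>v x) = A *\<^sub>v map_vec Im x"
  using assms by (intro eq_vecI) (auto simp: scalar_prod_def)

text \<open>A real matrix commutes with taking real and imaginary parts, so T x = z x with x = u + i
  v splits into two real equations. This makes the real definition of \<open>sym_pos_def\<close>
  applicable to complex eigenvectors. Only one of \<open>u\<close>, \<open>v\<close> has to be
  nonzero.\<close>

lemma eigenvalue_real_matE:
  assumes T: "T \<in> carrier_mat n n"
    and ev: "eigenvalue (map_mat complex_of_real T) z"
  obtains u v where "u \<in> carrier_vec n" "v \<in> carrier_vec n" "u \<noteq> 0\<^sub>v n \<or> v \<noteq> 0\<^sub>v n"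
    "T *\<^sub>v u = Re z \<cdot>\<^sub>v u - Im z \<cdot>\<^sub>v v" "T *\<^sub>v v = Re z \<cdot>\<^sub>v v + Im z \<cdot>\<^sub>v u"
proof -
  from ev T obtain x where x: "x \<in> carrier_vec n" "x \<noteq> 0\<^sub>v n"
    and Tx: "map_mat complex_of_real T *\<^sub>v x = z \<cdot>\<^sub>v x"
    unfolding eigenvalue_def eigenvector_def by auto
  show thesis
  proof (rule that[of "map_vec Re x" "map_vec Im x"])
    obtain i where i: "i < n" "x $ i \<noteq> 0"
      using x by (metis carrier_vecD eq_vecI index_zero_vec)
    then have "map_vec Re x $ i \<noteq> 0 \<or> map_vec Im x $ i \<noteq> 0"
      using x by (simp add: complex_eq_iff)
    then show "map_vec Re x \<noteq> 0\<^sub>v n \<or> map_vec Im x \<noteq> 0\<^sub>v n" using i by auto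
    show "T *\<^sub>v map_vec Re x = Re z \<cdot>\<^sub>v map_vec Re x - Im z \<cdot>\<^sub>v map_vec Im x"
      unfolding map_vec_Re_mult[OF T x(1), symmetric] Tx using x by (intro eq_vecI) auto
    show "T *\<^sub>v map_vec Im x = Re z \<cdot>\<^sub>v map_vec Im x + Im z \<cdot>\<^sub>v map_vec Re x"
      unfolding map_vec_Im_mult[OF T x(1), symmetric] Tx using x by (intro eq_vecI) auto
  qed (use x in auto)
qed

lemma mat_inverse_of_injective:
  fixes P :: "'a :: field mat"
  assumes P: "P \<in> carrier_mat n n"
    and inj: "\<And>v. v \<in> carrier_vec n \<Longrightarrow> P *\<^sub>v v = 0\<^sub>v n \<Longrightarrow> v = 0\<^sub>v n"
  obtains Q where "mat_inverse P = Some Q" "P * Q = 1\<^sub>m n" "Q \<in> carrier_mat n n"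
proof -
  have "det P \<noteq> 0" using det_0_iff_vec_prod_zero_field[OF P] inj by blast
  \<comment> \<open>The value \<open>()\<close> fills a free parameter of the matrix ring, so that
    both facts speak about units of the same ring.\<close>
  then have "mat_inverse P \<noteq> None"
    using det_non_zero_imp_unit[OF P, of "()"] mat_inverse(1)[OF P, of "()"] by blast
  then show thesis using that mat_inverse(2)[OF P] by blast
qed

lemma sym_pos_def_nonneg:
  assumes "sym_pos_def n S" "v \<in> carrier_vec n"
  shows "v \<bullet> (S *\<^sub>v v) \<ge> 0"
  using assms unfolding sym_pos_def_def
  by (cases "v = 0\<^sub>v n") (auto simp: less_imp_le)

lemma sym_pos_def_eq_0_iff:
  assumes "sym_pos_def n S" "v \<in> carrier_vec n"
  shows "v \<bullet> (S *\<^sub>v v) = 0 \<longleftrightarrow> v = 0\<^sub>v n"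
  using assms unfolding sym_pos_def_def
  by (cases "v = 0\<^sub>v n") (auto simp: less_le)

lemma sym_pos_def_commute:
  assumes "sym_pos_def n S" "u \<in> carrier_vec n" "v \<in> carrier_vec n"
  shows "u \<bullet> (S *\<^sub>v v) = v \<bullet> (S *\<^sub>v u)"
proof -
  have S: "S \<in> carrier_mat n n" "transpose_mat S = S"
    using assms(1) unfolding sym_pos_def_def by auto
  have "u \<bullet> (S *\<^sub>v v) = (S *\<^sub>v u) \<bullet> v"
    using transpose_vec_mult_scalar[OF S(1) assms(3,2)] S(2) by simp
  also have "\<dots> = v \<bullet> (S *\<^sub>v u)" using S assms by (intro comm_scalar_prod) auto
  finally show ?thesis .
qed

text \<open>With kappa = k + i l and q = y + i y', the two equations say kappa q = q in every entry,
  and \<open>kl\<close> says that kappa differs from 1.\<close>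

lemma real_pair_fixed_point_zero:
  fixes y y' :: "real vec"
  assumes y: "y \<in> carrier_vec n" "y' \<in> carrier_vec n"
    and eqs: "\<And>i. i < n \<Longrightarrow> y $ i = k * y $ i - l * y' $ i"
      "\<And>i. i < n \<Longrightarrow> y' $ i = k * y' $ i + l * y $ i"
    and kl: "k \<noteq> 1 \<or> l \<noteq> 0"
  shows "y = 0\<^sub>v n \<and> y' = 0\<^sub>v n"
proof -
  have "y $ i = 0 \<and> y' $ i = 0" if i: "i < n" for i
  proof -
    \<comment> \<open>Real and imaginary part of conj(kappa - 1) (kappa - 1) q. Folding
      \<open>eqs\<close> back turns each bracket on the right into an entry minus itself.\<close>
    have "((k - 1)\<^sup>2 + l\<^sup>2) * y $ i =
        (k - 1) * (k * y $ i - l * y' $ i - y $ i) + l * (k * y' $ i + l * y $ i - y' $ i)"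
      "((k - 1)\<^sup>2 + l\<^sup>2) * y' $ i =
        (k - 1) * (k * y' $ i + l * y $ i - y' $ i) - l * (k * y $ i - l * y' $ i - y $ i)"
      by (simp_all add: power2_eq_square algebra_simps)
    then have "((k - 1)\<^sup>2 + l\<^sup>2) * y $ i = 0" "((k - 1)\<^sup>2 + l\<^sup>2) * y' $ i = 0"
      unfolding eqs[OF i, symmetric] by simp_all
    then show ?thesis using kl by auto
  qed
  then show ?thesis using y by auto
qed

text \<open>For z = a + i b and w = \<alpha> + i \<beta> the hypotheses are the real and imaginary
  part of w = z (h + s w). Multiplying z - 1 by X + i Y = h + s w gives w - (h + s w), and X > 0
  allows cancelling the squared modulus of h + s w at the end.\<close>

lemma unit_disk_of_real_parts:
  fixes a b h s \<alpha> \<beta> :: real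
  assumes "\<alpha> = a * (h + s * \<alpha>) - b * (s * \<beta>)" "\<beta> = a * (s * \<beta>) + b * (h + s * \<alpha>)"
    and pos: "h > 0" "\<alpha> > 0" "s \<ge> 1 / 2"
  shows "(a - 1)\<^sup>2 + b\<^sup>2 < 1"
proof -
  define X Y where "X = h + s * \<alpha>" and "Y = s * \<beta>"
  have ab: "\<alpha> = a * X - b * Y" "\<beta> = a * Y + b * X" using assms(1,2) unfolding X_def Y_def by auto
  have X: "X > 0" using pos unfolding X_def by (simp add: add_pos_pos)
  have "((a - 1)\<^sup>2 + b\<^sup>2) * (X\<^sup>2 + Y\<^sup>2) = (\<alpha> - X)\<^sup>2 + (\<beta> - Y)\<^sup>2"
    unfolding ab by (simp add: power2_eq_square algebra_simps)
  also have "\<dots> = X\<^sup>2 + Y\<^sup>2 - (2 * h * \<alpha> + (2 * s - 1) * (\<alpha>\<^sup>2 + \<beta>\<^sup>2))"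
    unfolding X_def Y_def by (simp add: power2_eq_square algebra_simps)
  \<comment> \<open>Strictness comes from 2 h \<alpha> alone, so the borderline value s = 1/2, where
    the other term vanishes, is included.\<close>
  also have "\<dots> < X\<^sup>2 + Y\<^sup>2"
  proof -
    have "2 * h * \<alpha> > 0" using pos by simp
    moreover have "(2 * s - 1) * (\<alpha>\<^sup>2 + \<beta>\<^sup>2) \<ge> 0" using pos by simp
    ultimately show ?thesis by linarith
  qed
  finally have "((a - 1)\<^sup>2 + b\<^sup>2) * (X\<^sup>2 + Y\<^sup>2) < 1 * (X\<^sup>2 + Y\<^sup>2)" by simp
  moreover have "X\<^sup>2 + Y\<^sup>2 > 0" using X by (simp add: sum_power2_gt_zero_iff)
  ultimately show ?thesis using mult_less_cancel_right_pos by blast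
qed

section \<open>Block matrices acting on split vectors\<close>

lemma sym_pos_def_four_block_mat:
  assumes S: "sym_pos_def n S" and T: "sym_pos_def m T"
  shows "sym_pos_def (n + m) (four_block_mat S (0\<^sub>m n m) (0\<^sub>m m n) T)" (is "sym_pos_def _ ?D")
proof -
  have ST: "S \<in> carrier_mat n n" "transpose_mat S = S" "T \<in> carrier_mat m m" "transpose_mat T = T"
    using S T unfolding sym_pos_def_def by auto
  have "v \<bullet> (?D *\<^sub>v v) > 0" if v: "v \<in> carrier_vec (n + m)" "v \<noteq> 0\<^sub>v (n + m)" for v
  proof -
    obtain x y where xy: "x \<in> carrier_vec n" "y \<in> carrier_vec m" "v = x @\<^sub>v y"
      using vec_first_last_append[OF v(1)] vec_first_carrier vec_last_carrier by metis
    have "x \<noteq> 0\<^sub>v n \<or> y \<noteq> 0\<^sub>v m" using v(2) xy by auto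
    then have "x \<bullet> (S *\<^sub>v x) \<noteq> 0 \<or> y \<bullet> (T *\<^sub>v y) \<noteq> 0"
      using sym_pos_def_eq_0_iff[OF S xy(1)] sym_pos_def_eq_0_iff[OF T xy(2)] by simp
    then have "x \<bullet> (S *\<^sub>v x) + y \<bullet> (T *\<^sub>v y) > 0"
      using sym_pos_def_nonneg[OF S xy(1)] sym_pos_def_nonneg[OF T xy(2)] by linarith
    moreover have "?D *\<^sub>v v = (S *\<^sub>v x) @\<^sub>v (T *\<^sub>v y)"
      unfolding xy(3) using mult_mat_vec_split[OF ST(1,3) xy(1,2)] .
    moreover have "v \<bullet> ((S *\<^sub>v x) @\<^sub>v (T *\<^sub>v y)) = x \<bullet> (S *\<^sub>v x) + y \<bullet> (T *\<^sub>v y)"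
      unfolding xy(3) using ST xy by (intro scalar_prod_append) auto
    ultimately show ?thesis by simp
  qed
  moreover have "transpose_mat ?D = ?D"
    using ST by (subst transpose_four_block_mat[of _ n n _ m _ m]) auto
  moreover have "?D \<in> carrier_mat (n + m) (n + m)" using ST by auto
  ultimately show ?thesis unfolding sym_pos_def_def by blast
qed

lemma diag_block_mat3:
  assumes "L1 \<in> carrier_mat n n" "L2 \<in> carrier_mat m m" "L3 \<in> carrier_mat p p"
  shows "diag_block_mat [L1, L2, L3] = four_block_mat L1 (0\<^sub>m n (m + p)) (0\<^sub>m (m + p) n)
    (four_block_mat L2 (0\<^sub>m m p) (0\<^sub>m p m) L3)"
  \<comment> \<open>The pattern \<open>_ # _\<close> stops the recursion at the singleton list; one
    more unfolding would border \<open>L3\<close> with a 0 by 0 block.\<close>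
  unfolding diag_block_mat.simps(2)[of _ "_ # _"] diag_block_mat_singleton Let_def
  using assms by auto

lemma append_cols_mult_vec:
  assumes "M \<in> carrier_mat nr n1" "N \<in> carrier_mat nr n2"
    and "x \<in> carrier_vec n1" "y \<in> carrier_vec n2"
  shows "(M @\<^sub>c N) *\<^sub>v (x @\<^sub>v y) = M *\<^sub>v x + N *\<^sub>v (y :: 'a :: comm_ring_1 vec)"
  unfolding append_cols_def
  \<comment> \<open>The lower two blocks have no rows, so the lower half of the product is the empty
    vector.\<close>
  using assms by (subst four_block_mat_mult_vec[of _ nr n1 _ n2 _ 0]) auto

lemma saddle_mat_mult_vec:
  assumes A: "A \<in> carrier_mat n n" and B: "B \<in> carrier_mat m n" and C: "C \<in> carrier_mat p m"
    and x: "x \<in> carrier_vec n" and y: "y \<in> carrier_vec m" and w: "w \<in> carrier_vec p"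
  shows "saddle_mat A B C *\<^sub>v (x @\<^sub>v y @\<^sub>v w) =
    (A *\<^sub>v x + transpose_mat B *\<^sub>v y) @\<^sub>v (- (B *\<^sub>v x) - transpose_mat C *\<^sub>v w) @\<^sub>v (C *\<^sub>v y)"
proof -
  note c = A B C x y w
  have v: "x @\<^sub>v y @\<^sub>v w \<in> carrier_vec (n + (m + p))" using c by auto
  have r1: "(A @\<^sub>c transpose_mat B @\<^sub>c 0\<^sub>m n p) *\<^sub>v (x @\<^sub>v y @\<^sub>v w) = A *\<^sub>v x + transpose_mat B *\<^sub>v y"
    using c by (subst append_cols_mult_vec[of _ n n _ "m + p"];
      (subst append_cols_mult_vec[of _ n m _ p])?) auto
  have r2: "((- B) @\<^sub>c 0\<^sub>m m m @\<^sub>c (- transpose_mat C)) *\<^sub>v (x @\<^sub>v y @\<^sub>v w)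
      = - (B *\<^sub>v x) - transpose_mat C *\<^sub>v w"
    using c by (subst append_cols_mult_vec[of _ m n _ "m + p"];
      (subst append_cols_mult_vec[of _ m m _ p])?) auto
  have r3: "(0\<^sub>m p n @\<^sub>c C @\<^sub>c 0\<^sub>m p p) *\<^sub>v (x @\<^sub>v y @\<^sub>v w) = C *\<^sub>v y"
    using c by (subst append_cols_mult_vec[of _ p n _ "m + p"];
      (subst append_cols_mult_vec[of _ p m _ p])?) auto
  show ?thesis
    unfolding r1[symmetric] r2[symmetric] r3[symmetric] saddle_mat_def Let_def
    using c v
    by (subst mat_mult_append[of _ n "n + (m + p)" _ "m + p"];
      (subst mat_mult_append[of _ m "n + (m + p)" _ p])?) auto
qed

section \<open>The saddle point matrix and the preconditioner under the standing hypotheses\<close>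

locale pess =
  fixes n m p :: nat and A B C L1 L2 L3 :: "real mat" and s :: real
  assumes A: "sym_pos_def n A"
    and B: "B \<in> carrier_mat m n" "full_row_rank B"
    and C: "C \<in> carrier_mat p m" "full_row_rank C"
    and L: "sym_pos_def n L1" "sym_pos_def m L2" "sym_pos_def p L3"
    and s: "s \<ge> 1 / 2"
begin

abbreviation N where "N \<equiv> n + (m + p)"
abbreviation M where "M \<equiv> saddle_mat A B C"
abbreviation S where "S \<equiv> diag_block_mat [L1, L2, L3]"
abbreviation P where "P \<equiv> pess_mat L1 L2 L3 s A B C"

lemma carrier_blocks:
  "A \<in> carrier_mat n n" "L1 \<in> carrier_mat n n" "L2 \<in> carrier_mat m m" "L3 \<in> carrier_mat p p"
  using A L unfolding sym_pos_def_def by auto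

lemma M_carrier: "M \<in> carrier_mat N N"
  using saddle_mat_carrier carrier_blocks(1) B(1) C(1) .

lemma S_pos_def: "sym_pos_def N S"
  unfolding diag_block_mat3[OF carrier_blocks(2-4)]
  using L by (intro sym_pos_def_four_block_mat)

lemma S_carrier: "S \<in> carrier_mat N N"
  using S_pos_def unfolding sym_pos_def_def by blast

lemma P_carrier: "P \<in> carrier_mat N N"
  unfolding pess_mat_def using M_carrier S_carrier by auto

lemma P_mult_vec:
  assumes "v \<in> carrier_vec N"
  shows "P *\<^sub>v v = S *\<^sub>v v + s \<cdot>\<^sub>v (M *\<^sub>v v)"
proof -
  have "(s \<cdot>\<^sub>m M) *\<^sub>v v = s \<cdot>\<^sub>v (M *\<^sub>v v)"
    using M_carrier assms by (intro eq_vecI) auto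
  then show ?thesis
    unfolding pess_mat_def
    using add_mult_distrib_mat_vec[of S N N "s \<cdot>\<^sub>m M" v] M_carrier S_carrier assms by simp
qed

lemma block_vecE:
  assumes "v \<in> carrier_vec N"
  obtains x y w where "x \<in> carrier_vec n" "y \<in> carrier_vec m" "w \<in> carrier_vec p" "v = x @\<^sub>v y @\<^sub>v w"
proof -
  have "v = vec_first v n @\<^sub>v vec_last v (m + p)"
    using vec_first_last_append[OF assms] by simp
  also have "vec_last v (m + p) = vec_first (vec_last v (m + p)) m @\<^sub>v vec_last (vec_last v (m + p)) p"
    using vec_first_last_append[of "vec_last v (m + p)" m p] by simp
  finally show thesis using that vec_first_carrier vec_last_carrier by metis
qed

section \<open>Quadratic forms, nonsingularity, and the degenerate case\<close>

text \<open>Moving the transposes across the scalar product shows that \<open>B\<close> contributes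
  y . B x twice with opposite signs, and \<open>C\<close> contributes w . C y in the same way. Only
  the term of \<open>A\<close> survives.\<close>

lemma M_form:
  assumes "x \<in> carrier_vec n" "y \<in> carrier_vec m" "w \<in> carrier_vec p"
  shows "(x @\<^sub>v y @\<^sub>v w) \<bullet> (M *\<^sub>v (x @\<^sub>v y @\<^sub>v w)) = x \<bullet> (A *\<^sub>v x)"
proof -
  note c = carrier_blocks(1) B(1) C(1) assms
  have By: "x \<bullet> (transpose_mat B *\<^sub>v y) = y \<bullet> (B *\<^sub>v x)"
    using transpose_vec_mult_scalar[OF B(1) assms(1,2)] comm_scalar_prod[of x n] c by auto
  have Cw: "y \<bullet> (transpose_mat C *\<^sub>v w) = w \<bullet> (C *\<^sub>v y)"
    using transpose_vec_mult_scalar[OF C(1) assms(2,3)] comm_scalar_prod[of y m] c by auto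
  have "(x @\<^sub>v y @\<^sub>v w) \<bullet> (M *\<^sub>v (x @\<^sub>v y @\<^sub>v w)) =
      x \<bullet> (A *\<^sub>v x + transpose_mat B *\<^sub>v y) + (y \<bullet> (- (B *\<^sub>v x) - transpose_mat C *\<^sub>v w) + w \<bullet> (C *\<^sub>v y))"
    unfolding saddle_mat_mult_vec[OF c]
    using c by (subst scalar_prod_append[of _ n _ "m + p"]; (subst scalar_prod_append[of _ m _ p])?) auto
  also have "x \<bullet> (A *\<^sub>v x + transpose_mat B *\<^sub>v y) = x \<bullet> (A *\<^sub>v x) + y \<bullet> (B *\<^sub>v x)"
    unfolding By[symmetric] using c by (intro scalar_prod_add_distrib) auto
  also have "y \<bullet> (- (B *\<^sub>v x) - transpose_mat C *\<^sub>v w) = - (y \<bullet> (B *\<^sub>v x)) - w \<bullet> (C *\<^sub>v y)"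
    unfolding Cw[symmetric] using c by (subst scalar_prod_minus_distrib[of _ m]) auto
  finally show ?thesis by simp
qed

lemma M_form_nonneg:
  assumes "v \<in> carrier_vec N"
  shows "v \<bullet> (M *\<^sub>v v) \<ge> 0"
  using block_vecE[OF assms] M_form sym_pos_def_nonneg[OF A] by metis

lemma P_form:
  assumes "u \<in> carrier_vec N" "v \<in> carrier_vec N"
  shows "u \<bullet> (P *\<^sub>v v) = u \<bullet> (S *\<^sub>v v) + s * (u \<bullet> (M *\<^sub>v v))"
  unfolding P_mult_vec[OF assms(2)]
  using assms S_carrier M_carrier by (subst scalar_prod_add_distrib[of _ N]) auto

text \<open>This supplies the nonsingularity that \<open>pess_preconditioned\<close> tacitly relies
  on. If P v = 0, the nonnegative numbers v . S v and s (v . M v) add up to 0, so the definite form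
  of \<open>S\<close> vanishes at \<open>v\<close>.\<close>

lemma P_injective:
  assumes v: "v \<in> carrier_vec N" and "P *\<^sub>v v = 0\<^sub>v N"
  shows "v = 0\<^sub>v N"
proof -
  have "v \<bullet> (S *\<^sub>v v) + s * (v \<bullet> (M *\<^sub>v v)) = 0"
    using P_form[OF v v] assms by simp
  moreover have "s * (v \<bullet> (M *\<^sub>v v)) \<ge> 0" using M_form_nonneg[OF v] s by simp
  ultimately have "v \<bullet> (S *\<^sub>v v) = 0" using sym_pos_def_nonneg[OF S_pos_def v] by linarith
  then show ?thesis using sym_pos_def_eq_0_iff[OF S_pos_def v] by simp
qed

text \<open>Here \<open>mat_inverse\<close> is eliminated: the later arguments know the
  preconditioned matrix only through its product with \<open>P\<close>, which turns its eigenvalue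
  equation into M x = z P x.\<close>

lemma preconditioned_carrier:
  "pess_preconditioned L1 L2 L3 s A B C \<in> carrier_mat N N" (is ?carrier)
  and P_mult_preconditioned: "P * pess_preconditioned L1 L2 L3 s A B C = M" (is ?inverse)
proof -
  obtain Q where Q: "mat_inverse P = Some Q" "P * Q = 1\<^sub>m N" "Q \<in> carrier_mat N N"
    using mat_inverse_of_injective[OF P_carrier P_injective] by blast
  have T: "pess_preconditioned L1 L2 L3 s A B C = Q * M"
    unfolding pess_preconditioned_def Q(1) by simp
  show ?carrier unfolding T using Q M_carrier by auto
  show ?inverse unfolding T
    using assoc_mult_mat[OF P_carrier Q(3) M_carrier] Q(2) M_carrier by simp
qed

text \<open>If the form of \<^term>\<open>M\<close> vanishes at both vectors, their leading blocks are zero, and the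
  first two block rows of the pencil, together with the full row ranks of \<^term>\<open>B\<close> and
  \<^term>\<open>C\<close>, annihilate the remaining blocks one after the other.\<close>

lemma pencil_pair_eq_0:
  assumes u: "u \<in> carrier_vec N" and v: "v \<in> carrier_vec N"
    and Mu: "M *\<^sub>v u = a \<cdot>\<^sub>v (P *\<^sub>v u) - b \<cdot>\<^sub>v (P *\<^sub>v v)"
    and Mv: "M *\<^sub>v v = a \<cdot>\<^sub>v (P *\<^sub>v v) + b \<cdot>\<^sub>v (P *\<^sub>v u)"
    and nondeg: "a * s \<noteq> 1 \<or> b * s \<noteq> 0"
    and "u \<bullet> (M *\<^sub>v u) = 0" "v \<bullet> (M *\<^sub>v v) = 0"
  shows "u = 0\<^sub>v N" "v = 0\<^sub>v N"
proof -
  obtain x y w where u': "x \<in> carrier_vec n" "y \<in> carrier_vec m" "w \<in> carrier_vec p"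
    and ueq: "u = x @\<^sub>v y @\<^sub>v w" by (rule block_vecE[OF u])
  obtain x' y' w' where v': "x' \<in> carrier_vec n" "y' \<in> carrier_vec m" "w' \<in> carrier_vec p"
    and veq: "v = x' @\<^sub>v y' @\<^sub>v w'" by (rule block_vecE[OF v])
  have x0: "x = 0\<^sub>v n" "x' = 0\<^sub>v n"
    using M_form[OF u'] M_form[OF v'] assms(6,7) ueq veq
      sym_pos_def_eq_0_iff[OF A u'(1)] sym_pos_def_eq_0_iff[OF A v'(1)] by auto
  note c = carrier_blocks B(1) C(1) u' v'
  have block: "M *\<^sub>v (0\<^sub>v n @\<^sub>v y @\<^sub>v w) =
      (transpose_mat B *\<^sub>v y) @\<^sub>v (- (transpose_mat C *\<^sub>v w)) @\<^sub>v (C *\<^sub>v y)"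
    "S *\<^sub>v (0\<^sub>v n @\<^sub>v y @\<^sub>v w) = 0\<^sub>v n @\<^sub>v (L2 *\<^sub>v y) @\<^sub>v (L3 *\<^sub>v w)"
    if "y \<in> carrier_vec m" "w \<in> carrier_vec p" for y w
  proof -
    have "A *\<^sub>v 0\<^sub>v n = 0\<^sub>v n" "B *\<^sub>v 0\<^sub>v n = 0\<^sub>v m" "L1 *\<^sub>v 0\<^sub>v n = 0\<^sub>v n" using c by auto
    note z = this
    show "M *\<^sub>v (0\<^sub>v n @\<^sub>v y @\<^sub>v w) =
      (transpose_mat B *\<^sub>v y) @\<^sub>v (- (transpose_mat C *\<^sub>v w)) @\<^sub>v (C *\<^sub>v y)"
      unfolding saddle_mat_mult_vec[OF carrier_blocks(1) B(1) C(1) zero_carrier_vec that] z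
      using c that by auto
    show "S *\<^sub>v (0\<^sub>v n @\<^sub>v y @\<^sub>v w) = 0\<^sub>v n @\<^sub>v (L2 *\<^sub>v y) @\<^sub>v (L3 *\<^sub>v w)"
      unfolding diag_block_mat3[OF carrier_blocks(2-4)] using c that z
      by (subst mult_mat_vec_split; (subst mult_mat_vec_split)?) auto
  qed
  \<comment> \<open>The pencil equations entry by entry, with \<open>P\<close> expanded to S + s M,
    so that single block rows can be read off.\<close>
  have Mu_index: "(M *\<^sub>v u) $ i =
      a * ((S *\<^sub>v u) $ i + s * (M *\<^sub>v u) $ i) - b * ((S *\<^sub>v v) $ i + s * (M *\<^sub>v v) $ i)"
    if i: "i < N" for i
  proof -
    have "(M *\<^sub>v u) $ i = (a \<cdot>\<^sub>v (P *\<^sub>v u) - b \<cdot>\<^sub>v (P *\<^sub>v v)) $ i"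
      by (rule arg_cong[OF Mu])
    also have "\<dots> = a * ((S *\<^sub>v u) $ i + s * (M *\<^sub>v u) $ i) - b * ((S *\<^sub>v v) $ i + s * (M *\<^sub>v v) $ i)"
      unfolding P_mult_vec[OF u] P_mult_vec[OF v] using i M_carrier S_carrier by simp
    finally show ?thesis .
  qed
  have Mv_index: "(M *\<^sub>v v) $ i =
      a * ((S *\<^sub>v v) $ i + s * (M *\<^sub>v v) $ i) + b * ((S *\<^sub>v u) $ i + s * (M *\<^sub>v u) $ i)"
    if i: "i < N" for i
  proof -
    have "(M *\<^sub>v v) $ i = (a \<cdot>\<^sub>v (P *\<^sub>v v) + b \<cdot>\<^sub>v (P *\<^sub>v u)) $ i"
      by (rule arg_cong[OF Mv])
    also have "\<dots> = a * ((S *\<^sub>v v) $ i + s * (M *\<^sub>v v) $ i) + b * ((S *\<^sub>v u) $ i + s * (M *\<^sub>v u) $ i)"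
      unfolding P_mult_vec[OF u] P_mult_vec[OF v] using i M_carrier S_carrier by simp
    finally show ?thesis .
  qed
  note block_uv = ueq veq x0 block[OF u'(2,3)] block[OF v'(2,3)]
  have row1: "(M *\<^sub>v u) $ i = (transpose_mat B *\<^sub>v y) $ i" "(S *\<^sub>v u) $ i = 0"
    "(M *\<^sub>v v) $ i = (transpose_mat B *\<^sub>v y') $ i" "(S *\<^sub>v v) $ i = 0" "i < N"
    if "i < n" for i
    unfolding block_uv using that c by auto
  \<comment> \<open>In the first block row \<open>S\<close> contributes nothing, because the leading
    blocks are zero. With z = a + i b and q = y + i y' what remains is B^T q = z s B^T q, and
    \<open>nondeg\<close> says that z s differs from 1.\<close>
  have "transpose_mat B *\<^sub>v y = 0\<^sub>v n \<and> transpose_mat B *\<^sub>v y' = 0\<^sub>v n"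
  proof (rule real_pair_fixed_point_zero[OF _ _ _ _ nondeg])
    show "(transpose_mat B *\<^sub>v y) $ i =
        a * s * (transpose_mat B *\<^sub>v y) $ i - b * s * (transpose_mat B *\<^sub>v y') $ i"
      if "i < n" for i
      using Mu_index[OF row1(5)[OF that]] unfolding row1[OF that] add_0 mult.assoc .
    show "(transpose_mat B *\<^sub>v y') $ i =
        a * s * (transpose_mat B *\<^sub>v y') $ i + b * s * (transpose_mat B *\<^sub>v y) $ i"
      if "i < n" for i
      using Mv_index[OF row1(5)[OF that]] unfolding row1[OF that] add_0 mult.assoc .
  qed (use c in auto)
  then have y0: "y = 0\<^sub>v m" "y' = 0\<^sub>v m"
    using full_row_rank_transpose_kernel[OF B] u' v' by auto
  have "L2 *\<^sub>v 0\<^sub>v m = 0\<^sub>v m" using c by auto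
  then have row2: "(M *\<^sub>v u) $ (n + i) = - (transpose_mat C *\<^sub>v w) $ i" "(S *\<^sub>v u) $ (n + i) = 0"
    "(M *\<^sub>v v) $ (n + i) = - (transpose_mat C *\<^sub>v w') $ i" "(S *\<^sub>v v) $ (n + i) = 0" "n + i < N"
    if "i < m" for i
    unfolding block_uv unfolding y0 using that c by auto
  \<comment> \<open>Now that \<open>y\<close> and \<open>y'\<close> are zero, \<open>S\<close>
    contributes nothing in the second block row either, and the same argument applies to C^T (w + i
    w').\<close>
  have "transpose_mat C *\<^sub>v w = 0\<^sub>v m \<and> transpose_mat C *\<^sub>v w' = 0\<^sub>v m"
  proof (rule real_pair_fixed_point_zero[OF _ _ _ _ nondeg])
    show "(transpose_mat C *\<^sub>v w) $ i =
        a * s * (transpose_mat C *\<^sub>v w) $ i - b * s * (transpose_mat C *\<^sub>v w') $ i"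
      if "i < m" for i
      using Mu_index[OF row2(5)[OF that]] unfolding row2[OF that] by (simp add: mult.assoc)
    show "(transpose_mat C *\<^sub>v w') $ i =
        a * s * (transpose_mat C *\<^sub>v w') $ i + b * s * (transpose_mat C *\<^sub>v w) $ i"
      if "i < m" for i
      using Mv_index[OF row2(5)[OF that]] unfolding row2[OF that] by (simp add: mult.assoc)
  qed (use c in auto)
  then have w0: "w = 0\<^sub>v p" "w' = 0\<^sub>v p"
    using full_row_rank_transpose_kernel[OF C] u' v' by auto
  show "u = 0\<^sub>v N" "v = 0\<^sub>v N" unfolding ueq veq x0 y0 w0 by auto
qed

section \<open>From an eigenvalue to the open disk\<close>

lemma eigenvalue_in_disk:
  assumes ev: "eigenvalue (map_mat complex_of_real (pess_preconditioned L1 L2 L3 s A B C)) z"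
  shows "cmod (z - 1) < 1"
proof -
  let ?T = "pess_preconditioned L1 L2 L3 s A B C"
  define a b where "a = Re z" and "b = Im z"
  obtain u v where u: "u \<in> carrier_vec N" and v: "v \<in> carrier_vec N" and ne: "u \<noteq> 0\<^sub>v N \<or> v \<noteq> 0\<^sub>v N"
    and Tu: "?T *\<^sub>v u = a \<cdot>\<^sub>v u - b \<cdot>\<^sub>v v" and Tv: "?T *\<^sub>v v = a \<cdot>\<^sub>v v + b \<cdot>\<^sub>v u"
    using eigenvalue_real_matE[OF preconditioned_carrier ev] unfolding a_def b_def by blast
  have PT: "P *\<^sub>v (?T *\<^sub>v x) = M *\<^sub>v x" if "x \<in> carrier_vec N" for x
    using assoc_mult_mat_vec[OF P_carrier preconditioned_carrier that] P_mult_preconditioned by simp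
  have Mu: "M *\<^sub>v u = a \<cdot>\<^sub>v (P *\<^sub>v u) - b \<cdot>\<^sub>v (P *\<^sub>v v)"
    unfolding PT[OF u, symmetric] Tu using u v P_carrier
    by (simp add: mult_minus_distrib_mat_vec[OF P_carrier] mult_mat_vec[OF P_carrier])
  have Mv: "M *\<^sub>v v = a \<cdot>\<^sub>v (P *\<^sub>v v) + b \<cdot>\<^sub>v (P *\<^sub>v u)"
    unfolding PT[OF v, symmetric] Tv using u v P_carrier
    by (simp add: mult_add_distrib_mat_vec[OF P_carrier] mult_mat_vec[OF P_carrier])
  \<comment> \<open>For x = u + i v these are h = x* S x and \<alpha> + i \<beta> = x* M x, obtained
    by expanding (u - i v) . M (u + i v).\<close>
  define h \<alpha> \<beta> where "h = u \<bullet> (S *\<^sub>v u) + v \<bullet> (S *\<^sub>v v)"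
    and "\<alpha> = u \<bullet> (M *\<^sub>v u) + v \<bullet> (M *\<^sub>v v)" and "\<beta> = u \<bullet> (M *\<^sub>v v) - v \<bullet> (M *\<^sub>v u)"
  note nonneg = M_form_nonneg[OF u] M_form_nonneg[OF v]
    sym_pos_def_nonneg[OF S_pos_def u] sym_pos_def_nonneg[OF S_pos_def v]
  have h: "h > 0"
    using ne nonneg sym_pos_def_eq_0_iff[OF S_pos_def u] sym_pos_def_eq_0_iff[OF S_pos_def v]
    unfolding h_def by linarith
  have scalar_u: "x \<bullet> (M *\<^sub>v u) = a * (x \<bullet> (P *\<^sub>v u)) - b * (x \<bullet> (P *\<^sub>v v))"
    if x: "x \<in> carrier_vec N" for x
    unfolding Mu using x u v P_carrier by (subst scalar_prod_minus_distrib[of _ N]) auto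
  have scalar_v: "x \<bullet> (M *\<^sub>v v) = a * (x \<bullet> (P *\<^sub>v v)) + b * (x \<bullet> (P *\<^sub>v u))"
    if x: "x \<in> carrier_vec N" for x
    unfolding Mv using x u v P_carrier by (subst scalar_prod_add_distrib[of _ N]) auto
  \<comment> \<open>The last fact makes the cross terms u . S v and v . S u cancel: x* S x has no
    imaginary part.\<close>
  note forms = P_form[OF u u] P_form[OF v v] P_form[OF u v] P_form[OF v u]
    sym_pos_def_commute[OF S_pos_def v u]
  have "\<alpha> = (a * (u \<bullet> (P *\<^sub>v u)) - b * (u \<bullet> (P *\<^sub>v v))) + (a * (v \<bullet> (P *\<^sub>v v)) + b * (v \<bullet> (P *\<^sub>v u)))"
    unfolding \<alpha>_def by (rule arg_cong2[OF scalar_u[OF u] scalar_v[OF v]])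
  also have "\<dots> = a * (h + s * \<alpha>) - b * (s * \<beta>)"
    unfolding forms h_def \<alpha>_def \<beta>_def by (simp add: algebra_simps)
  finally have \<alpha>: "\<alpha> = a * (h + s * \<alpha>) - b * (s * \<beta>)" .
  have "\<beta> = (a * (u \<bullet> (P *\<^sub>v v)) + b * (u \<bullet> (P *\<^sub>v u))) - (a * (v \<bullet> (P *\<^sub>v u)) - b * (v \<bullet> (P *\<^sub>v v)))"
    unfolding \<beta>_def by (rule arg_cong2[OF scalar_v[OF u] scalar_u[OF v]])
  also have "\<dots> = a * (s * \<beta>) + b * (h + s * \<alpha>)"
    unfolding forms h_def \<alpha>_def \<beta>_def by (simp add: algebra_simps)
  finally have \<beta>: "\<beta> = a * (s * \<beta>) + b * (h + s * \<alpha>)" .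
  have "\<alpha> \<noteq> 0"
  proof
    assume "\<alpha> = 0"
    then have "u \<bullet> (M *\<^sub>v u) = 0" "v \<bullet> (M *\<^sub>v v) = 0" using nonneg unfolding \<alpha>_def by linarith+
    \<comment> \<open>If a s = 1 and b s = 0, then b = 0 and a is nonzero because s > 0. The
      equation for \<alpha> = 0 would then read 0 = a h, against h > 0.\<close>
    moreover have "a * s \<noteq> 1 \<or> b * s \<noteq> 0" using \<alpha> h s \<open>\<alpha> = 0\<close> by auto
    ultimately show False using pencil_pair_eq_0[OF u v Mu Mv] ne by blast
  qed
  then have "\<alpha> > 0" using nonneg unfolding \<alpha>_def by linarith
  then have "(a - 1)\<^sup>2 + b\<^sup>2 < 1" using unit_disk_of_real_parts[OF \<alpha> \<beta> h] s by blast
  then show ?thesis unfolding cmod_def a_def b_def by simp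
qed

end

section \<open>A uniform radius from finiteness of the spectrum\<close>

theorem theorem4p1:
  fixes n m p :: nat and A B C L1 L2 L3 :: "real mat" and s :: real
  assumes "sym_pos_def n A"
    and "B \<in> carrier_mat m n" and "full_row_rank B"
    and "C \<in> carrier_mat p m" and "full_row_rank C"
    and "sym_pos_def n L1" and "sym_pos_def m L2" and "sym_pos_def p L3"
    and "s \<ge> 1 / 2"
  shows "(\<forall>z :: complex.
            eigenvalue (map_mat complex_of_real (pess_preconditioned L1 L2 L3 s A B C)) z \<longrightarrow>
            cmod (z - 1) < 1) \<and>
         (\<exists>r. 0 < r \<and> r < 1 \<and>
            spectrum (map_mat complex_of_real (pess_preconditioned L1 L2 L3 s A B C))
              \<subseteq> {z. cmod (z - 1) < r})"
proof -
  interpret pess n m p A B C L1 L2 L3 s using assms by unfold_locales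
  let ?T = "map_mat complex_of_real (pess_preconditioned L1 L2 L3 s A B C)"
  \<comment> \<open>Finitely many distances below 1 have a maximum below 1, and \<open>r\<close> is
    chosen strictly between that maximum and 1. Inserting 0 keeps \<open>Max\<close> meaningful when
    the spectrum is empty, as in dimension 0, and forces r > 0.\<close>
  define R where "R = insert 0 ((\<lambda>z. cmod (z - 1)) ` spectrum ?T)"
  have "finite (spectrum ?T)"
    using preconditioned_carrier by (intro card_finite_spectrum(1)[of _ N]) simp
  then have R: "finite R" "R \<noteq> {}" unfolding R_def by auto
  have "Max R < 1"
    using R eigenvalue_in_disk unfolding R_def spectrum_def by (subst Max_less_iff) auto
  then obtain r where r: "Max R < r" "r < 1" using dense by blast
  then have R_less: "x < r" if "x \<in> R" for x using that R by simp
  then have "0 < r" "spectrum ?T \<subseteq> {z. cmod (z - 1) < r}" unfolding R_def by auto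
  then show ?thesis using r eigenvalue_in_disk by blast
qed

end
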